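(* Let $\Bbbk$ be a field of characteristic zero, let $k\ge 2$, and let $d\ge 1$ satisfy $d\equiv 1\pmod{k-1}$. Suppose that $A$ is a $k$-ary $\Bbbk$-algebra, with operation $(a_1,\ldots,a_k)\mapsto (a_1a_2\ldots a_k)$, that satisfies the identity $w_d^{(k)}=0$. Then the symmetrized product $$[a_1\ldots a_k]=\sum_{\sigma\in S_k}(a_{\sigma(1)}\ldots a_{\sigma(k)})$$ on $A$ satisfies the identity $t_d^{(k)}=0$.
   Context: A $k$-ary algebra is a $\Bbbk$-vector space $A$ with a $k$-linear operation $A^{\otimes k}\to A$, with no symmetry or associativity assumed. For $n\equiv 1\pmod{k-1}$, $w_n^{(k)}(a_1,\ldots,a_n)$ is the sum of all distinct multilinear terms of degree $n$ obtained by iterating the $k$-ary operation with the arguments $a_1,\ldots,a_n$ placed in the natural order (one term for each planar rooted $k$-ary tree with $n$ leaves; $w_1^{(k)}(a_1)=a_1$). For a totally commutative (i.e. invariant under all permutations of its arguments) $k$-linear operation $[-,\ldots,-]$ on $A$, and $n\equiv 1\pmod{k-1}$, $t_n^{(k)}(a_1,\ldots,a_n)$ is the sum of all distinct multilinear terms of degree $n$ in $a_1,\ldots,a_n$ (each used exactly once, in any order) obtained by iterating this operation, where terms that coincide due to total commutativity are counted once (one term for each non-planar rooted $k$-ary tree with leaves labelled bijectively by $1,\ldots,n$; $t_1^{(k)}(a_1)=a_1$). An identity holds if the operation vanishes for all arguments from $A$. *)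

theory Defs
  imports Complex_Main "HOL-Number_Theory.Cong" "HOL-Library.Multiset" "HOL-Combinatorics.Permutations"
begin

text \<open>
  An operation with k arguments on a type is represented by a function on lists, of which only
  the values on lists of length k matter.
\<close>

definition multilinear ::
  "('k::field \<Rightarrow> 'a::ab_group_add \<Rightarrow> 'a) \<Rightarrow> nat \<Rightarrow> ('a list \<Rightarrow> 'a) \<Rightarrow> bool" where
  "multilinear scale k f \<longleftrightarrow>
     (\<forall>xs ys. length xs + 1 + length ys = k \<longrightarrow>
        Vector_Spaces.linear scale scale (\<lambda>x. f (xs @ x # ys)))"

definition totally_commutative :: "nat \<Rightarrow> ('a list \<Rightarrow> 'a) \<Rightarrow> bool" where
  "totally_commutative k f \<longleftrightarrow>
     (\<forall>xs \<sigma>. length xs = k \<longrightarrow> \<sigma> permutes {..<k} \<longrightarrow> f (permute_list \<sigma> xs) = f xs)"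

definition symmetrized :: "nat \<Rightarrow> ('a list \<Rightarrow> 'a) \<Rightarrow> 'a list \<Rightarrow> 'a::ab_group_add" where
  "symmetrized k f xs = (\<Sum>\<sigma> | \<sigma> permutes {..<k}. f (permute_list \<sigma> xs))"


section \<open>Planar trees\<close>

datatype ptree = PLeaf nat | PNode "ptree list"

primrec p_kary :: "nat \<Rightarrow> ptree \<Rightarrow> bool" where
  "p_kary k (PLeaf i) \<longleftrightarrow> True"
| "p_kary k (PNode ts) \<longleftrightarrow> length ts = k \<and> list_all id (map (p_kary k) ts)"

primrec p_leaves :: "ptree \<Rightarrow> nat list" where
  "p_leaves (PLeaf i) = [i]"
| "p_leaves (PNode ts) = concat (map p_leaves ts)"

primrec p_eval :: "('a list \<Rightarrow> 'a) \<Rightarrow> (nat \<Rightarrow> 'a) \<Rightarrow> ptree \<Rightarrow> 'a" where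
  "p_eval f a (PLeaf i) = a i"
| "p_eval f a (PNode ts) = f (map (p_eval f a) ts)"

text \<open>
  Labelling the leaves from left to right by 1, ..., n turns planar rooted k-ary trees with n
  leaves into the trees below. The arguments are a 1, ..., a n.
\<close>

definition planar_trees :: "nat \<Rightarrow> nat \<Rightarrow> ptree set" where
  "planar_trees k n = {t. p_kary k t \<and> p_leaves t = [1..<Suc n]}"

definition w_op :: "nat \<Rightarrow> nat \<Rightarrow> ('a list \<Rightarrow> 'a) \<Rightarrow> (nat \<Rightarrow> 'a) \<Rightarrow> 'a::ab_group_add" where
  "w_op k n f a = (\<Sum>t\<in>planar_trees k n. p_eval f a t)"


section \<open>Non-planar trees\<close>

datatype ntree = NLeaf nat | NNode "ntree multiset"

primrec n_kary :: "nat \<Rightarrow> ntree \<Rightarrow> bool" where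
  "n_kary k (NLeaf i) \<longleftrightarrow> True"
| "n_kary k (NNode M) \<longleftrightarrow> size M = k \<and> (\<forall>b\<in>#image_mset (n_kary k) M. b)"

primrec n_labels :: "ntree \<Rightarrow> nat multiset" where
  "n_labels (NLeaf i) = {#i#}"
| "n_labels (NNode M) = \<Sum>\<^sub># (image_mset n_labels M)"

text \<open>
  A totally commutative operation takes the same value on all orderings of a multiset of
  arguments, so the choice made here is immaterial for such operations.
\<close>

definition on_mset :: "('a list \<Rightarrow> 'a) \<Rightarrow> 'a multiset \<Rightarrow> 'a" where
  "on_mset f M = f (SOME xs. mset xs = M)"

lemma on_mset_mset:
  assumes "totally_commutative k f" and "length xs = k"
  shows "on_mset f (mset xs) = f xs"
proof -
  have "mset (SOME ys. mset ys = mset xs) = mset xs"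
    by (rule someI) (rule refl)
  then obtain \<sigma> where "\<sigma> permutes {..<length xs}"
      "permute_list \<sigma> xs = (SOME ys. mset ys = mset xs)"
    by (metis mset_eq_permutation)
  with assms show ?thesis
    unfolding on_mset_def totally_commutative_def by metis
qed

lemma totally_commutative_symmetrized: "totally_commutative k (symmetrized k f)"
  unfolding totally_commutative_def
proof (intro allI impI)
  fix xs :: "'a list" and \<pi>
  assume len: "length xs = k" and \<pi>: "\<pi> permutes {..<k}"
  have "symmetrized k f (permute_list \<pi> xs) =
      (\<Sum>\<sigma> | \<sigma> permutes {..<k}. f (permute_list (\<pi> \<circ> \<sigma>) xs))"
    unfolding symmetrized_def using len
    by (intro sum.cong refl) (simp add: permute_list_compose)
  also have "\<dots> = symmetrized k f xs"
    unfolding symmetrized_def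
    by (rule setum_permutations_compose_left[OF \<pi>, symmetric])
  finally show "symmetrized k f (permute_list \<pi> xs) = symmetrized k f xs" .
qed

primrec n_eval :: "('a list \<Rightarrow> 'a) \<Rightarrow> (nat \<Rightarrow> 'a) \<Rightarrow> ntree \<Rightarrow> 'a" where
  "n_eval f a (NLeaf i) = a i"
| "n_eval f a (NNode M) = on_mset f (image_mset (n_eval f a) M)"

definition nonplanar_trees :: "nat \<Rightarrow> nat \<Rightarrow> ntree set" where
  "nonplanar_trees k n = {t. n_kary k t \<and> n_labels t = mset_set {1..n}}"

text \<open>Meaningful for totally commutative operations only.\<close>

definition t_op :: "nat \<Rightarrow> nat \<Rightarrow> ('a list \<Rightarrow> 'a) \<Rightarrow> (nat \<Rightarrow> 'a) \<Rightarrow> 'a::ab_group_add" where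
  "t_op k n f a = (\<Sum>t\<in>nonplanar_trees k n. n_eval f a t)"


section \<open>Finiteness of the index sets\<close>

lemma size_n_labels_pos: "n_kary k t \<Longrightarrow> 2 \<le> k \<Longrightarrow> 1 \<le> size (n_labels t)"
proof (induction t)
  case (NNode M)
  then obtain t N where M: "M = add_mset t N"
    by (cases M) auto
  have "1 \<le> size (n_labels t)"
    using NNode by (simp add: M)
  then show ?case by (simp add: M)
qed simp

lemma finite_ntrees:
  assumes k: "2 \<le> k" and S: "finite S"
  shows "finite {t. n_kary k t \<and> set_mset (n_labels t) \<subseteq> S \<and> size (n_labels t) \<le> n}"
proof (induction n)
  case 0
  have "{t. n_kary k t \<and> set_mset (n_labels t) \<subseteq> S \<and> size (n_labels t) \<le> 0} = {}"
    using size_n_labels_pos[OF _ k] by fastforce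
  then show ?case by (simp only: finite.emptyI)
next
  case (Suc n)
  let ?F = "{t. n_kary k t \<and> set_mset (n_labels t) \<subseteq> S \<and> size (n_labels t) \<le> n}"
  have "t \<in> NLeaf ` S \<union> (\<lambda>ts. NNode (mset ts)) ` {ts. set ts \<subseteq> ?F \<and> length ts = k}"
    if t: "n_kary k t" "set_mset (n_labels t) \<subseteq> S" "size (n_labels t) \<le> Suc n" for t
  proof (cases t)
    case (NNode M)
    obtain ts where ts: "M = mset ts" by (metis ex_mset)
    have "u \<in> ?F" if u: "u \<in># M" for u
    proof -
      obtain N where N: "M = add_mset u N" using u by (metis mset_add)
      then have "N \<noteq> {#}" using t(1) NNode k by auto
      then obtain v N' where N': "N = add_mset v N'" by (cases N) auto
      have "1 \<le> size (n_labels v)"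
        using t(1) NNode N N' size_n_labels_pos[OF _ k] by auto
      then show ?thesis using t NNode N N' by auto
    qed
    then have "ts \<in> {ts. set ts \<subseteq> ?F \<and> length ts = k}"
      using NNode ts t(1) by auto
    then show ?thesis unfolding NNode ts by (intro UnI2 imageI)
  qed (use t in auto)
  moreover have "finite (NLeaf ` S \<union> (\<lambda>ts. NNode (mset ts)) ` {ts. set ts \<subseteq> ?F \<and> length ts = k})"
    using S Suc by (intro finite_UnI finite_imageI finite_lists_length_eq)
  ultimately show ?case
    by (rule_tac finite_subset) (auto simp only: subset_iff mem_Collect_eq)
qed

lemma finite_nonplanar_trees: "2 \<le> k \<Longrightarrow> finite (nonplanar_trees k n)"
  unfolding nonplanar_trees_def
  by (rule finite_subset[OF _ finite_ntrees[of k "{1..n}" n]]) auto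

lemma length_p_leaves_pos: "p_kary k t \<Longrightarrow> 2 \<le> k \<Longrightarrow> 1 \<le> length (p_leaves t)"
proof (induction t)
  case (PNode ts)
  then obtain t us where ts: "ts = t # us"
    by (cases ts) auto
  have "1 \<le> length (p_leaves t)"
    using PNode by (simp add: ts)
  then show ?case by (simp add: ts)
qed simp

lemma finite_ptrees:
  assumes k: "2 \<le> k" and S: "finite S"
  shows "finite {t. p_kary k t \<and> set (p_leaves t) \<subseteq> S \<and> length (p_leaves t) \<le> n}"
proof (induction n)
  case 0
  have "{t. p_kary k t \<and> set (p_leaves t) \<subseteq> S \<and> length (p_leaves t) \<le> 0} = {}"
    using length_p_leaves_pos[OF _ k] by fastforce
  then show ?case by (simp only: finite.emptyI)
next
  case (Suc n)
  let ?F = "{t. p_kary k t \<and> set (p_leaves t) \<subseteq> S \<and> length (p_leaves t) \<le> n}"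
  have "t \<in> PLeaf ` S \<union> PNode ` {ts. set ts \<subseteq> ?F \<and> length ts = k}"
    if t: "p_kary k t" "set (p_leaves t) \<subseteq> S" "length (p_leaves t) \<le> Suc n" for t
  proof (cases t)
    case (PNode ts)
    have "u \<in> ?F" if u: "u \<in> set ts" for u
    proof -
      obtain xs ys where ts: "ts = xs @ u # ys" using u by (metis split_list)
      then have "xs @ ys \<noteq> []" using t(1) PNode k by auto
      then obtain v where v: "v \<in> set (xs @ ys)" by (meson list.set_sel(1))
      then have "1 \<le> length (p_leaves v)"
        using t(1) PNode ts length_p_leaves_pos[OF _ k] by (auto simp: list_all_iff)
      moreover have "length (p_leaves v) \<le> length (concat (map p_leaves (xs @ ys)))"
        using v by (simp only: length_concat map_map)
          (rule member_le_sum_list, auto)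
      ultimately show ?thesis using t PNode ts by (auto simp: list_all_iff)
    qed
    then have "ts \<in> {ts. set ts \<subseteq> ?F \<and> length ts = k}"
      using PNode t(1) by auto
    then show ?thesis unfolding PNode by (intro UnI2 imageI)
  qed (use t in auto)
  moreover have "finite (PLeaf ` S \<union> PNode ` {ts. set ts \<subseteq> ?F \<and> length ts = k})"
    using S Suc by (intro finite_UnI finite_imageI finite_lists_length_eq)
  ultimately show ?case
    by (rule_tac finite_subset) (auto simp only: subset_iff mem_Collect_eq)
qed

lemma finite_planar_trees: "2 \<le> k \<Longrightarrow> finite (planar_trees k n)"
  unfolding planar_trees_def
  by (rule finite_subset[OF _ finite_ptrees[of k "{1..n}" n]]) auto

end

theory Submission
  imports Defs
begin

text \<open>
  Expanding every symmetrized product in the value of a non-planar tree gives the sum of the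
  values of its planar representatives, each occurring exactly once because distinct leaf labels
  make the children of each node distinct. Hence t_d of the symmetrized product at a is the sum
  over all labelled planar trees; sorted by the order of the leaves, this is the sum of
  w_d over all permutations of the arguments.
\<close>

section \<open>Planar representatives of a non-planar tree, as fibres of
  \<open>shape\<close>\<close>

primrec shape :: "ptree \<Rightarrow> ntree" where
  "shape (PLeaf i) = NLeaf i"
| "shape (PNode ts) = NNode (mset (map shape ts))"

lemma n_kary_shape: "n_kary k (shape P) \<longleftrightarrow> p_kary k P"
  by (induction P) (auto simp: list_all_iff)

lemma n_labels_shape: "n_labels (shape P) = mset (p_leaves P)"
proof (induction P)
  case (PNode ts)
  then show ?case by (induction ts) auto
qed simp

lemma shape_eq_NLeaf: "{P. shape P = NLeaf i} = {PLeaf i}"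
proof -
  have "shape P = NLeaf i \<longleftrightarrow> P = PLeaf i" for P by (cases P) auto
  then show ?thesis by simp
qed

text \<open>Recursive description of the fibres: the root children may stand in any order, and each
  is itself a planar representative of a child in \<open>M\<close>. The inductions over non-planar
  trees rest on it.\<close>

lemma shape_eq_NNode: "{P. shape P = NNode M} = PNode ` {Ps. mset (map shape Ps) = M}"
proof -
  have "shape P = NNode M \<longleftrightarrow> P \<in> PNode ` {Ps. mset (map shape Ps) = M}" for P
    by (cases P) auto
  then show ?thesis by blast
qed

lemma finite_shape_fiber: "finite {P. shape P = t}"
proof (induction t)
  case (NLeaf i)
  then show ?case by (simp add: shape_eq_NLeaf)
next
  case (NNode M)
  let ?F = "\<Union>u\<in>set_mset M. {P. shape P = u}"
  have "{Ps. mset (map shape Ps) = M} \<subseteq> {Ps. set Ps \<subseteq> ?F \<and> length Ps = size M}"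
    by (auto simp flip: size_mset)
  moreover have "finite {Ps. set Ps \<subseteq> ?F \<and> length Ps = size M}"
    using NNode by (intro finite_lists_length_eq) auto
  ultimately show ?case
    unfolding shape_eq_NNode by (intro finite_imageI) (rule finite_subset)
qed

section \<open>Expansion of symmetrized products\<close>

lemma multilinear_expand:
  assumes "multilinear scale k f" and "length xs + length us = k"
    and "\<And>u. finite {P. s P = u}"
  shows "f (xs @ map (\<lambda>u. \<Sum>P | s P = u. h P) us) = (\<Sum>Ps | map s Ps = us. f (xs @ map h Ps))"
  using assms(2)
\<comment> \<open>The prefix \<open>xs\<close> collects the arguments already expanded. Linearity
  splits the first remaining argument into summands \<open>h P\<close>; each joins the prefix, and
  the induction hypothesis treats the rest.\<close>
proof (induction us arbitrary: xs)
  case (Cons u us)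
  let ?g = "\<lambda>u. \<Sum>P | s P = u. h P"
  have fin: "finite {Ps. map s Ps = vs}" for vs
  proof (rule finite_subset)
    show "{Ps. map s Ps = vs} \<subseteq> {Ps. set Ps \<subseteq> (\<Union>v\<in>set vs. {P. s P = v}) \<and> length Ps = length vs}"
      by auto
    show "finite {Ps. set Ps \<subseteq> (\<Union>v\<in>set vs. {P. s P = v}) \<and> length Ps = length vs}"
      using assms(3) by (intro finite_lists_length_eq) auto
  qed
  have lin: "Vector_Spaces.linear scale scale (\<lambda>x. f (xs @ x # map ?g us))"
    using assms(1) Cons.prems unfolding multilinear_def by auto
  have "f (xs @ map ?g (u # us)) = (\<Sum>P | s P = u. f (xs @ h P # map ?g us))"
    using module_hom.sum[OF lin[unfolded Vector_Spaces.linear_def, THEN conjunct2, THEN conjunct2]] by simp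
  also have "\<dots> = (\<Sum>P | s P = u. \<Sum>Ps | map s Ps = us. f (xs @ h P # map h Ps))"
    using Cons.IH[of "xs @ [h P]" for P] Cons.prems by (intro sum.cong) auto
  also have "\<dots> = (\<Sum>(P, Ps)\<in>{P. s P = u} \<times> {Ps. map s Ps = us}. f (xs @ h P # map h Ps))"
    by (rule sum.cartesian_product)
  also have "\<dots> = (\<Sum>Ps | map s Ps = u # us. f (xs @ map h Ps))"
    by (rule sum.reindex_bij_witness[where j = "\<lambda>(P, Ps). P # Ps" and i = "\<lambda>Ps. (hd Ps, tl Ps)"])
      (auto simp: map_eq_Cons_conv)
  finally show ?case .
qed simp

text \<open>With distinct entries a permutation can be recovered from the rearranged list, so every
  arrangement arises exactly once and the sum over permutations has no multiplicities.\<close>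

lemma sum_permute_list:
  assumes "distinct ts"
  shows "(\<Sum>\<sigma> | \<sigma> permutes {..<length ts}. g (permute_list \<sigma> ts)) = (\<Sum>us | mset us = mset ts. g us)"
proof (rule sum.reindex_cong[symmetric])
  show "inj_on (\<lambda>\<sigma>. permute_list \<sigma> ts) {\<sigma>. \<sigma> permutes {..<length ts}}"
  proof (rule inj_onI, clarify)
    fix \<sigma> \<tau> assume st: "\<sigma> permutes {..<length ts}" "\<tau> permutes {..<length ts}"
      and eq: "permute_list \<sigma> ts = permute_list \<tau> ts"
    show "\<sigma> = \<tau>"
    proof
      fix i
      show "\<sigma> i = \<tau> i"
      proof (cases "i < length ts")
        case True
        then have "ts ! \<sigma> i = ts ! \<tau> i" "\<sigma> i < length ts" "\<tau> i < length ts"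
          using eq st permute_list_nth permutes_in_image by (metis lessThan_iff)+
        then show ?thesis using assms by (simp add: nth_eq_iff_index_eq)
      qed (use st in \<open>simp add: permutes_def\<close>)
    qed
  qed
  show "{us. mset us = mset ts} = (\<lambda>\<sigma>. permute_list \<sigma> ts) ` {\<sigma>. \<sigma> permutes {..<length ts}}"
    by (auto elim!: mset_eq_permutation)
qed simp

lemma count_n_labels_child:
  assumes "u \<in># M"
  shows "count (n_labels u) x \<le> count (n_labels (NNode M)) x"
proof -
  obtain N where "M = add_mset u N" using assms by (metis mset_add)
  then show ?thesis by simp
qed

text \<open>Two equal children would carry the same labels, and each child has at least one label
  because nodes without children are excluded by \<open>2 \<le> k\<close>. Some label would then
  occur twice.\<close>

lemma distinct_children:
  assumes "2 \<le> k" and "n_kary k (NNode (mset ts))"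
    and "\<And>x. count (n_labels (NNode (mset ts))) x \<le> 1"
  shows "distinct ts"
proof (rule ccontr)
  assume "\<not> distinct ts"
  then obtain xs y ys zs where ts: "ts = xs @ [y] @ ys @ [y] @ zs"
    using not_distinct_decomp by blast
  have "n_kary k y" using assms(2) by (simp add: ts)
  then have "n_labels y \<noteq> {#}" using size_n_labels_pos assms(1) by force
  then obtain x where "x \<in># n_labels y" by blast
  then have "count (n_labels y) x \<ge> 1" by simp
  moreover have "2 * count (n_labels y) x \<le> count (n_labels (NNode (mset ts))) x"
    by (simp add: ts)
  ultimately show False using assms(3)[of x] by linarith
qed

text \<open>The label condition only bounds multiplicities by one: this is inherited by subtrees,
  whereas being labelled exactly by 1, ..., n is not.\<close>

lemma n_eval_symmetrized:
  assumes "2 \<le> k" and "multilinear scale k f"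
    and "n_kary k t" and "\<And>x. count (n_labels t) x \<le> 1"
  shows "n_eval (symmetrized k f) a t = (\<Sum>P | shape P = t. p_eval f a P)"
  using assms(3,4)
proof (induction t)
  case (NLeaf i)
  then show ?case by (simp add: shape_eq_NLeaf)
next
  case (NNode M)
  let ?n = "n_eval (symmetrized k f) a"
  let ?g = "\<lambda>u. \<Sum>P | shape P = u. p_eval f a P"
  obtain ts where M: "M = mset ts" by (metis ex_mset)
  have len: "length ts = k" using NNode.prems M by simp
  have dist: "distinct ts"
    using distinct_children assms(1) NNode.prems unfolding M by blast
  have IH: "?n u = ?g u" if "u \<in># M" for u
  proof (rule NNode.IH[OF that])
    show "n_kary k u" using NNode.prems(1) that by simp
    show "count (n_labels u) x \<le> 1" for x
      using count_n_labels_child[OF that] NNode.prems(2) order_trans by blast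
  qed
  have fin: "finite {us. mset us = M}"
    unfolding M by (rule finite_subset[OF _ finite_lists_length_eq[of "set ts" k]])
      (auto simp: len dest: mset_eq_setD mset_eq_length)
  have fin': "finite {Ps. map shape Ps = us}" for us
    by (rule finite_subset[OF _ finite_lists_length_eq[of "\<Union>u\<in>set us. {P. shape P = u}" "length us"]])
      (auto intro: finite_shape_fiber)
  \<comment> \<open>Total commutativity of \<open>symmetrized k f\<close> allows the ordering chosen
    inside \<open>on_mset\<close> to be replaced by that of \<open>ts\<close>.\<close>
  have "?n (NNode M) = symmetrized k f (map ?n ts)"
    using on_mset_mset[OF totally_commutative_symmetrized, of "map ?n ts" k f]
    by (simp add: M len)
  also have "map ?n ts = map ?g ts"
    using IH by (simp add: M)
  also have "symmetrized k f (map ?g ts) =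
      (\<Sum>\<sigma> | \<sigma> permutes {..<length ts}. f (map ?g (permute_list \<sigma> ts)))"
    unfolding symmetrized_def len by (intro sum.cong) (auto simp: permute_list_map len)
  also have "\<dots> = (\<Sum>us | mset us = M. f (map ?g us))"
    unfolding M by (rule sum_permute_list[OF dist])
  also have "\<dots> = (\<Sum>us | mset us = M. \<Sum>Ps | map shape Ps = us. f (map (p_eval f a) Ps))"
  proof (rule sum.cong[OF refl])
    fix us assume "us \<in> {us. mset us = M}"
    then have "length us = k" using len M by (auto dest: mset_eq_length)
    then show "f (map ?g us) = (\<Sum>Ps | map shape Ps = us. f (map (p_eval f a) Ps))"
      using multilinear_expand[OF assms(2) _ finite_shape_fiber, of "[]" us "p_eval f a"] by simp
  qed
  also have "\<dots> = (\<Sum>(us, Ps)\<in>Sigma {us. mset us = M} (\<lambda>us. {Ps. map shape Ps = us}).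
      f (map (p_eval f a) Ps))"
    using fin fin' by (simp add: sum.Sigma)
  \<comment> \<open>The list \<open>Ps\<close> determines \<open>us\<close> as
    \<open>map shape Ps\<close>, so the pairs correspond to planar trees \<open>PNode Ps\<close>.
    The leaf case missing from the inverse map never occurs in this fibre.\<close>
  also have "\<dots> = (\<Sum>P | shape P = NNode M. p_eval f a P)"
    unfolding shape_eq_NNode
    by (rule sum.reindex_bij_witness[where j = "\<lambda>(us, Ps). PNode Ps"
          and i = "\<lambda>P. case P of PNode Ps \<Rightarrow> (map shape Ps, Ps)"]) auto
  finally show ?case .
qed

section \<open>Relabelling of leaves and summation over their orders\<close>

primrec relabel :: "(nat \<Rightarrow> nat) \<Rightarrow> ptree \<Rightarrow> ptree" where
  "relabel g (PLeaf i) = PLeaf (g i)"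
| "relabel g (PNode ts) = PNode (map (relabel g) ts)"

lemma relabel_relabel: "relabel g (relabel h P) = relabel (g \<circ> h) P"
  by (induction P) auto

lemma relabel_id: "relabel id P = P"
  by (induction P) (auto simp: map_idI)

lemma p_kary_relabel: "p_kary k (relabel g P) \<longleftrightarrow> p_kary k P"
  by (induction P) (auto simp: list_all_iff)

lemma p_leaves_relabel: "p_leaves (relabel g P) = map g (p_leaves P)"
proof (induction P)
  case (PNode ts)
  then show ?case by (induction ts) auto
qed simp

lemma p_eval_relabel: "p_eval f a (relabel g P) = p_eval f (a \<circ> g) P"
  by (induction P) (auto simp: comp_def cong: map_cong)

text \<open>Permuting the arguments has the same effect on values as relabelling the leaves, and
  relabelling by \<open>inv p\<close> brings the leaves back to the natural order.\<close>

lemma w_op_comp: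
  assumes "p permutes S"
  shows "w_op k n f (a \<circ> p) =
    (\<Sum>P | p_kary k P \<and> p_leaves P = map p [1..<Suc n]. p_eval f a P)"
  unfolding w_op_def planar_trees_def
proof (rule sum.reindex_bij_witness[where j = "relabel p" and i = "relabel (inv p)"])
  have inv: "inv p \<circ> p = id" "p \<circ> inv p = id"
    using permutes_inv_o[OF assms] by auto
  show "relabel (inv p) (relabel p P) = P" "relabel p (relabel (inv p) P) = P" for P
    by (simp_all only: relabel_relabel inv relabel_id)
  show "relabel (inv p) P \<in> {t. p_kary k t \<and> p_leaves t = [1..<Suc n]}"
    if "P \<in> {P. p_kary k P \<and> p_leaves P = map p [1..<Suc n]}" for P
    using that by (simp only: mem_Collect_eq p_kary_relabel p_leaves_relabel map_map inv list.map_id)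
qed (simp_all only: mem_Collect_eq p_kary_relabel p_leaves_relabel p_eval_relabel)

lemma mset_eq_permutes_upt:
  assumes "mset xs = mset_set {1..n}"
  obtains p where "p permutes {1..n}" and "xs = map p [1..<Suc n]"
proof -
  have m: "mset xs = mset [1..<Suc n]"
    using assms by (simp only: mset_upt atLeastLessThanSuc_atLeastAtMost)
  have len: "length xs = n" using mset_eq_length[OF m] by simp
  have dist: "distinct xs" using mset_eq_imp_distinct_iff[OF m] by simp
  have set: "set xs = {1..n}"
    using mset_eq_setD[OF m] by (simp only: set_upt atLeastLessThanSuc_atLeastAtMost)
  \<comment> \<open>Labels start at 1 and list positions at 0, hence the shift; outside {1..n} the
    identity is forced by \<open>permutes\<close>.\<close>
  define p where "p i = (if i \<in> {1..n} then xs ! (i - 1) else i)" for i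
  have "bij_betw (\<lambda>i. xs ! (i - 1)) {1..n} {1..n}"
  proof (rule bij_betw_trans[where f = "\<lambda>i. i - 1" and g = "(!) xs" and A = "{1..n}" and B = "{..<n}", unfolded comp_def])
    show "bij_betw (\<lambda>i. i - 1) {1..n} {..<n}"
      by (rule bij_betw_byWitness[where f' = Suc]) auto
    show "bij_betw ((!) xs) {..<n} {1..n}"
      using bij_betw_nth[OF dist] len set by auto
  qed
  then have "bij_betw p {1..n} {1..n}"
    by (subst bij_betw_cong[of _ _ "\<lambda>i. xs ! (i - 1)"]) (auto simp: p_def)
  then have "p permutes {1..n}"
    by (rule bij_imp_permutes) (auto simp: p_def)
  moreover have "xs = map p [1..<Suc n]"
    by (rule nth_equalityI) (auto simp: len p_def simp del: upt_Suc)
  ultimately show ?thesis by (rule that)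
qed

text \<open>Double counting over \<open>?Z\<close>: grouping its trees by shape gives the left side,
  grouping them by leaf order the right side.\<close>

lemma t_op_symmetrized_eq_sum_w_op:
  assumes "2 \<le> k" and "multilinear scale k f"
  shows "t_op k n (symmetrized k f) a = (\<Sum>p | p permutes {1..n}. w_op k n f (a \<circ> p))"
proof -
  let ?Z = "{P. p_kary k P \<and> mset (p_leaves P) = mset_set {1..n}}"
  let ?m = "\<lambda>p. map p [1..<Suc n]"
  let ?\<Pi> = "{p. p permutes {1..n}}"
  have Z: "shape P \<in> nonplanar_trees k n \<longleftrightarrow> P \<in> ?Z" for P
    by (simp add: nonplanar_trees_def n_kary_shape n_labels_shape)
  have finN: "finite (nonplanar_trees k n)" using assms(1) by (rule finite_nonplanar_trees)
  have finZ: "finite ?Z"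
    by (rule finite_subset[of _ "\<Union>t\<in>nonplanar_trees k n. {P. shape P = t}"])
      (use Z finN finite_shape_fiber in auto)
  \<comment> \<open>The list gives the values on {1..n}, and elsewhere both permutations are the
    identity.\<close>
  have inj: "inj_on ?m ?\<Pi>"
  proof (rule inj_onI, clarify, rule ext)
    fix p q i assume pq: "p permutes {1..n}" "q permutes {1..n}" "?m p = ?m q"
    show "p i = q i"
    proof (cases "i \<in> {1..n}")
      case True
      then show ?thesis using pq(3) by (auto simp: map_eq_conv simp del: upt_Suc)
    qed (use pq in \<open>simp add: permutes_def\<close>)
  qed
  have leaves: "p_leaves ` ?Z \<subseteq> ?m ` ?\<Pi>"
  proof clarify
    fix P assume "mset (p_leaves P) = mset_set {1..n}"
    then show "p_leaves P \<in> ?m ` ?\<Pi>" by (rule mset_eq_permutes_upt) blast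
  qed
  have mset: "mset (?m p) = mset_set {1..n}" if "p permutes {1..n}" for p
  proof -
    have "mset (?m p) = image_mset p (mset_set {1..n})"
      by (simp only: mset_map mset_upt atLeastLessThanSuc_atLeastAtMost)
    also have "\<dots> = mset_set {1..n}"
      using that by (simp add: image_mset_mset_set permutes_inj_on permutes_image)
    finally show ?thesis .
  qed
  have "t_op k n (symmetrized k f) a = (\<Sum>t\<in>nonplanar_trees k n. \<Sum>P | P \<in> ?Z \<and> shape P = t. p_eval f a P)"
    unfolding t_op_def
  proof (rule sum.cong[OF refl])
    fix t assume t: "t \<in> nonplanar_trees k n"
    then have "n_eval (symmetrized k f) a t = (\<Sum>P | shape P = t. p_eval f a P)"
      using assms by (intro n_eval_symmetrized)
        (auto simp: nonplanar_trees_def count_mset_set')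
    \<comment> \<open>Arity and label multiset depend only on the shape, so the whole fibre over
      \<open>t\<close> lies in \<open>?Z\<close>.\<close>
    also have "{P. shape P = t} = {P. P \<in> ?Z \<and> shape P = t}"
      using t Z by blast
    finally show "n_eval (symmetrized k f) a t = (\<Sum>P | P \<in> ?Z \<and> shape P = t. p_eval f a P)" .
  qed
  also have "\<dots> = (\<Sum>P\<in>?Z. p_eval f a P)"
    using Z by (intro sum.group finZ finN) blast
  also have "\<dots> = (\<Sum>xs\<in>?m ` ?\<Pi>. \<Sum>P | P \<in> ?Z \<and> p_leaves P = xs. p_eval f a P)"
    using leaves by (intro sum.group[symmetric] finZ finite_imageI finite_permutations) auto
  also have "\<dots> = (\<Sum>p | p permutes {1..n}. \<Sum>P | P \<in> ?Z \<and> p_leaves P = ?m p. p_eval f a P)"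
    by (simp only: sum.reindex[OF inj] comp_def)
  also have "\<dots> = (\<Sum>p | p permutes {1..n}. w_op k n f (a \<circ> p))"
  proof (rule sum.cong[OF refl], clarify)
    fix p assume p: "p permutes {1..n}"
    \<comment> \<open>The leaf order \<open>?m p\<close> already forces the label multiset required
      in \<open>?Z\<close>.\<close>
    have "{P. P \<in> ?Z \<and> p_leaves P = ?m p} = {P. p_kary k P \<and> p_leaves P = ?m p}"
      using mset[OF p] by (auto simp del: upt_Suc)
    then show "(\<Sum>P | P \<in> ?Z \<and> p_leaves P = ?m p. p_eval f a P) = w_op k n f (a \<circ> p)"
      by (simp only: w_op_comp[OF p])
  qed
  finally show ?thesis .
qed

theorem proposition6:
  fixes scale :: "'k::field_char_0 \<Rightarrow> 'a::ab_group_add \<Rightarrow> 'a"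
    and f :: "'a list \<Rightarrow> 'a"
    and k d :: nat
  assumes "2 \<le> k"
    and "1 \<le> d"
    and "[d = 1] (mod (k - 1))"
    and "vector_space scale"
    and "multilinear scale k f"
    and "\<forall>a. w_op k d f a = 0"
  shows "\<forall>a. t_op k d (symmetrized k f) a = 0"
  \<comment> \<open>The identity for \<open>w_op\<close> holds at all arguments, in particular at
    every \<open>a \<circ> p\<close>, so each summand vanishes.\<close>
  using t_op_symmetrized_eq_sum_w_op[OF assms(1,5)] assms(6) by simp

end
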